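(* Let $n,s_1,s_2$ be non-negative integers such that $0\le s_1<s_2\le n-1$, and let $A$ and $B$ be two non-zero square complex matrices of order $r$ such that $AB=BA$. Then: 1. If $A$ is non-singular, then $$\det\left(P_n^{s_1}\otimes A+P_n^{s_2}\otimes B\right)=\det(P_n^{s_1})^{r}\,\det(A)^{n}\left[\det\left(I_r-(-A^{-1}B)^{\,n\backslash(s_2-s_1)}\right)\right]^{(n,\,s_2-s_1)}.$$ 2. If $B$ is non-singular and $A$ is singular, then $$\det\left(P_n^{s_1}\otimes A+P_n^{s_2}\otimes B\right)=\det(P_n^{s_2})^{r}\,\det(B)^{n}\left[\det\left(I_r-(-B^{-1}A)^{\,n\backslash(n-s_2+s_1)}\right)\right]^{(n,\,n-s_2+s_1)}.$$
   Context: Matrix indices run over $\{0,1,\dots,n-1\}$. $P_n$ is the $n\times n$ permutation matrix with $(P_n)_{i,j}=1$ if $j\equiv i+1\pmod n$ and $0$ otherwise; $P_n^0=I_n$. $\otimes$ is the Kronecker product. $(n,s)$ denotes the greatest common divisor of $n$ and $s$, and $n\backslash s:=n/(n,s)$. *)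

theory Defs
  imports Complex_Main
    "Jordan_Normal_Form.Determinant"
    "Jordan_Normal_Form.Gauss_Jordan_Elimination"
begin

definition cyclic_perm_mat :: "nat \<Rightarrow> complex mat" where
  "cyclic_perm_mat n = mat n n (\<lambda>(i, j). if j mod n = (i + 1) mod n then 1 else 0)"

(* The block matrix whose (i, j) block is the (i, j) entry of A times B;
   div selects the block and mod the position inside it. *)
definition kronecker_mat :: "'a :: semiring_1 mat \<Rightarrow> 'a mat \<Rightarrow> 'a mat" where
  "kronecker_mat A B =
     mat (dim_row A * dim_row B) (dim_col A * dim_col B)
       (\<lambda>(i, j). A $$ (i div dim_row B, j div dim_col B) * B $$ (i mod dim_row B, j mod dim_col B))"

definition div_gcd :: "nat \<Rightarrow> nat \<Rightarrow> nat" where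
  "div_gcd n s = n div gcd n s"

(* mat_inverse returns Some of the two-sided inverse exactly for invertible square
   matrices; on all other matrices inv_mat has an unspecified value. *)
definition inv_mat :: "'a :: field mat \<Rightarrow> 'a mat" where
  "inv_mat A = the (mat_inverse A)"

end

theory Submission
  imports Defs "Jordan_Normal_Form.Schur_Decomposition"
begin

text \<open>
  The discrete Fourier matrix diagonalises the cyclic permutation matrix, so for a primitive
  \<open>n\<close>-th root of unity \<open>w\<close> the determinant of the pencil is the product over \<open>j < n\<close> of the
  determinants of the blocks \<open>w ^ (j * s1) A + w ^ (j * s2) B\<close>. If \<open>A\<close> is invertible,
  factoring it out leaves the blocks \<open>I - w ^ (j * k) C\<close> with \<open>C = - (inv_mat A * B)\<close> and \<open>k = s2 - s1\<close>.
  Since \<open>w ^ k\<close> is a primitive root of unity of order \<open>m = n / gcd n k\<close>, each of its powers occurs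
  \<open>gcd n k\<close> times, and \<open>1 - y ^ m\<close> being the product of the factors \<open>1 - w ^ (b * k) y\<close>, \<open>b < m\<close>,
  applied to the eigenvalues of \<open>C\<close>, gives the formula. The second case is the first with the
  two summands exchanged, as only the residue of \<open>k\<close> modulo \<open>n\<close> matters.
\<close>

section \<open>Kronecker products and block diagonal determinants\<close>

lemma kronecker_mat_carrier:
  assumes "A \<in> carrier_mat a b" "B \<in> carrier_mat p q"
  shows "kronecker_mat A B \<in> carrier_mat (a * p) (b * q)"
  using assms unfolding kronecker_mat_def by auto

lemma kronecker_mat_index:
  assumes "A \<in> carrier_mat a b" "B \<in> carrier_mat p q" "i < a * p" "j < b * q"
  shows "kronecker_mat A B $$ (i, j) = A $$ (i div p, j div q) * B $$ (i mod p, j mod q)"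
  using assms unfolding kronecker_mat_def by auto

text \<open>Division with remainder by \<open>q\<close> identifies the indices
  \<open>l < b * q\<close> with pairs \<open>(x, y)\<close>. In a product of Kronecker matrices this
  separates the sum over blocks from the sum inside a block.\<close>

lemma sum_div_mod_product:
  fixes f g :: "nat \<Rightarrow> 'a :: comm_semiring_1"
  shows "(\<Sum>l<b * q. f (l div q) * g (l mod q)) = (\<Sum>x<b. f x) * (\<Sum>y<q. g y)"
proof (cases "q = 0")
  case False
  have "(\<Sum>x<b. f x) * (\<Sum>y<q. g y) = (\<Sum>(x, y)\<in>{..<b} \<times> {..<q}. f x * g y)"
    by (simp add: sum_product sum.cartesian_product)
  also have "\<dots> = (\<Sum>l<b * q. f (l div q) * g (l mod q))"
  proof (rule sum.reindex_bij_witness[of _ "\<lambda>l. (l div q, l mod q)" "\<lambda>(x, y). x * q + y"])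
    fix z assume "z \<in> {..<b} \<times> {..<q}"
    then obtain x y where z: "z = (x, y)" "x < b" "y < q" by auto
    have "x * q + y < Suc x * q" using z by simp
    also have "\<dots> \<le> b * q" using z by (intro mult_le_mono1) simp
    finally show "(case z of (x, y) \<Rightarrow> x * q + y) \<in> {..<b * q}" using z by simp
  qed (use False in \<open>auto simp: less_mult_imp_div_less\<close>)
  finally show ?thesis by simp
qed simp

text \<open>The mixed-product property. In each entry the summation index splits into a block index
  and an inner index; commutativity regroups the four factors, so the sum factors into an entry of
  \<open>A * C\<close> times an entry of \<open>B * D\<close>.\<close>

lemma kronecker_mat_mult:
  fixes A B C D :: "'a :: comm_semiring_1 mat"
  assumes A: "A \<in> carrier_mat a b" and B: "B \<in> carrier_mat p q"
    and C: "C \<in> carrier_mat b c" and D: "D \<in> carrier_mat q s"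
  shows "kronecker_mat A B * kronecker_mat C D = kronecker_mat (A * C) (B * D)"
proof (rule eq_matI)
  have AC: "A * C \<in> carrier_mat a c" and BD: "B * D \<in> carrier_mat p s" using assms by auto
  have K: "kronecker_mat A B \<in> carrier_mat (a * p) (b * q)" 
    "kronecker_mat C D \<in> carrier_mat (b * q) (c * s)"
    "kronecker_mat (A * C) (B * D) \<in> carrier_mat (a * p) (c * s)"
    using kronecker_mat_carrier[OF A B] kronecker_mat_carrier[OF C D] kronecker_mat_carrier[OF AC BD] by auto
  show "dim_row (kronecker_mat A B * kronecker_mat C D) = dim_row (kronecker_mat (A * C) (B * D))"
    "dim_col (kronecker_mat A B * kronecker_mat C D) = dim_col (kronecker_mat (A * C) (B * D))"
    using K by auto
  fix i j assume "i < dim_row (kronecker_mat (A * C) (B * D))" "j < dim_col (kronecker_mat (A * C) (B * D))"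
  hence i: "i < a * p" and j: "j < c * s" using K by auto
  hence ij: "i div p < a" "i mod p < p" "j div s < c" "j mod s < s"
    by (auto simp: less_mult_imp_div_less intro!: mod_less_divisor gr0I)
  let ?f = "\<lambda>x. A $$ (i div p, x) * C $$ (x, j div s)"
  let ?g = "\<lambda>y. B $$ (i mod p, y) * D $$ (y, j mod s)"
  have "(kronecker_mat A B * kronecker_mat C D) $$ (i, j)
      = (\<Sum>l<b * q. kronecker_mat A B $$ (i, l) * kronecker_mat C D $$ (l, j))"
    using K i j by (auto simp: scalar_prod_def lessThan_atLeast0)
  also have "\<dots> = (\<Sum>l<b * q. ?f (l div q) * ?g (l mod q))"
    by (rule sum.cong) (simp_all add: kronecker_mat_index[OF A B i] kronecker_mat_index[OF C D _ j] mult_ac)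
  also have "\<dots> = (\<Sum>x<b. ?f x) * (\<Sum>y<q. ?g y)" by (rule sum_div_mod_product)
  also have "\<dots> = kronecker_mat (A * C) (B * D) $$ (i, j)"
    using ij assms by (simp add: kronecker_mat_index[OF AC BD i j] scalar_prod_def lessThan_atLeast0)
  finally show "(kronecker_mat A B * kronecker_mat C D) $$ (i, j) = kronecker_mat (A * C) (B * D) $$ (i, j)" .
qed

lemma kronecker_mat_one: "kronecker_mat (1\<^sub>m n) (1\<^sub>m r) = 1\<^sub>m (n * r)"
proof (rule eq_matI)
  fix i j assume "i < dim_row (1\<^sub>m (n * r) :: 'a mat)" "j < dim_col (1\<^sub>m (n * r) :: 'a mat)"
  hence i: "i < n * r" and j: "j < n * r" by auto
  hence ij: "i div r < n" "i mod r < r" "j div r < n" "j mod r < r"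
    by (auto simp: less_mult_imp_div_less intro!: mod_less_divisor gr0I)
  have "i = j \<longleftrightarrow> i div r = j div r \<and> i mod r = j mod r" by (metis div_mult_mod_eq)
  then show "(kronecker_mat (1\<^sub>m n) (1\<^sub>m r) :: 'a mat) $$ (i, j) = 1\<^sub>m (n * r) $$ (i, j)"
    using i j ij by (subst kronecker_mat_index[of _ n n _ r r]) auto
qed (auto simp: kronecker_mat_def)

text \<open>Induction on the number of blocks, splitting off the last block as the lower right
  corner of a four-block matrix. The \<open>div\<close>/\<open>mod\<close> form is the one in which
  Kronecker products with a diagonal left factor arise.\<close>

lemma det_block_diagonal:
  fixes X :: "nat \<Rightarrow> 'a :: idom mat"
  assumes X: "\<And>j. j < n \<Longrightarrow> X j \<in> carrier_mat r r"
  shows "det (mat (n * r) (n * r)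
      (\<lambda>(i, j). if i div r = j div r then X (i div r) $$ (i mod r, j mod r) else 0)) = (\<Prod>j<n. det (X j))"
  using X
proof (induction n)
  case (Suc n)
  let ?M = "\<lambda>n. mat (n * r) (n * r)
      (\<lambda>(i, j). if i div r = j div r then X (i div r) $$ (i mod r, j mod r) else 0)"
  have Xn: "X n \<in> carrier_mat r r" by (rule Suc.prems) simp
  have low: "i div r < n" if "i < n * r" for i using that by (rule less_mult_imp_div_less)
  have high: "i div r = n" "i mod r = i - n * r" if "\<not> i < n * r" "i < Suc n * r" for i
  proof -
    show "i div r = n" using that by (intro div_nat_eqI) (simp_all add: mult.commute)
    then show "i mod r = i - n * r" by (metis minus_div_mult_eq_mod)
  qed
  have eq: "?M (Suc n) = four_block_mat (?M n) (0\<^sub>m (n * r) r) (0\<^sub>m r (n * r)) (X n)"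
  proof (rule eq_matI)
    fix i j assume "i < dim_row (four_block_mat (?M n) (0\<^sub>m (n * r) r) (0\<^sub>m r (n * r)) (X n))"
      "j < dim_col (four_block_mat (?M n) (0\<^sub>m (n * r) r) (0\<^sub>m r (n * r)) (X n))"
    hence ij: "i < Suc n * r" "j < Suc n * r" using Xn by auto
    show "?M (Suc n) $$ (i, j) = four_block_mat (?M n) (0\<^sub>m (n * r) r) (0\<^sub>m r (n * r)) (X n) $$ (i, j)"
      using ij Xn low[of i] low[of j] high[of i] high[of j]
      by (cases "i < n * r"; cases "j < n * r") auto
  qed (use Xn in auto)
  have "det (?M (Suc n)) = det (?M n) * det (X n)"
    unfolding eq by (rule det_four_block_mat_lower_left_zero) (use Xn in auto)
  then show ?case using Suc by simp
qed simp

section \<open>The Fourier matrix and roots of unity\<close>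

text \<open>Unnormalised, with \<open>w\<close> as a parameter: for a primitive \<open>n\<close>-th
  root of unity \<open>w\<close> the inverse is \<open>1 / n\<close> times the same matrix at
  \<open>inverse w\<close>.\<close>

definition dft_mat :: "nat \<Rightarrow> complex \<Rightarrow> complex mat" where
  "dft_mat n w = mat n n (\<lambda>(i, j). w ^ (i * j))"

text \<open>For \<open>w ^ n = 1\<close> the diagonal lists the eigenvalues of the
  \<open>s\<close>-th power of the cyclic permutation matrix.\<close>

definition power_diag_mat :: "nat \<Rightarrow> complex \<Rightarrow> nat \<Rightarrow> complex mat" where
  "power_diag_mat n w s = mat n n (\<lambda>(i, j). if i = j then w ^ (j * s) else 0)"

lemma dft_mat_carrier [simp]: "dft_mat n w \<in> carrier_mat n n"
  by (simp add: dft_mat_def)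

lemma power_diag_mat_carrier [simp]: "power_diag_mat n w s \<in> carrier_mat n n"
  by (simp add: power_diag_mat_def)

lemma cyclic_perm_mat_carrier [simp]: "cyclic_perm_mat n \<in> carrier_mat n n"
  by (simp add: cyclic_perm_mat_def)

text \<open>The equivalence expresses that \<open>w\<close> has order exactly \<open>n\<close>. For
  \<open>cis (2 * pi / n)\<close> exponents reduce modulo \<open>n\<close>, and the powers below
  \<open>n\<close> are distinct roots of unity.\<close>

lemma ex_primitive_root_unity:
  assumes "n > 0"
  obtains w :: complex where "\<And>j. w ^ j = 1 \<longleftrightarrow> n dvd j"
proof
  define w where "w = cis (2 * pi / n)"
  have pow: "w ^ j = cis (2 * pi * j / n)" for j
    unfolding w_def by (simp add: DeMoivre mult_ac)
  have n1: "w ^ n = 1" using assms by (simp add: pow)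
  fix j
  have red: "w ^ j = w ^ (j mod n)"
    by (metis n1 div_mult_mod_eq mult.commute mult_1 power_add power_mult power_one)
  have "inj_on (\<lambda>k. cis (2 * pi * real k / real n)) {..<n}"
    using bij_betw_roots_unity[OF assms] by (rule bij_betw_imp_inj_on)
  from inj_on_eq_iff[OF this, of "j mod n" 0] have "w ^ (j mod n) = 1 \<longleftrightarrow> j mod n = 0"
    using assms by (simp add: pow)
  with red show "w ^ j = 1 \<longleftrightarrow> n dvd j" by (simp add: dvd_eq_mod_eq_0)
qed

text \<open>Cancelling the smaller power from \<open>w ^ i = w ^ j\<close> leaves
  \<open>w ^ (j - i) = 1\<close>, so \<open>n\<close> divides a number below
  \<open>n\<close>.\<close>

lemma primitive_root_power_inj:
  fixes w :: complex
  assumes "\<And>j. w ^ j = 1 \<longleftrightarrow> n dvd j" "w \<noteq> 0"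
  shows "inj_on (\<lambda>j. w ^ j) {..<n}"
proof -
  have le: "i = j" if "i \<le> j" "j < n" "w ^ i = w ^ j" for i j
  proof -
    have "w ^ i * w ^ (j - i) = w ^ j" using that(1) by (simp flip: power_add)
    then have "w ^ i * w ^ (j - i) = w ^ i * 1" using that(3) by simp
    then have "w ^ (j - i) = 1" using assms(2) by simp
    then have "n dvd j - i" using assms(1) by blast
    with that show ?thesis by (auto dest: dvd_imp_le)
  qed
  show ?thesis 
    by (rule inj_onI) (metis le lessThan_iff nat_le_linear)
qed

lemma prod_one_minus_primitive_root:
  fixes z y :: complex
  assumes m: "m > 0" and z: "\<And>j. z ^ j = 1 \<longleftrightarrow> m dvd j"
  shows "(\<Prod>b<m. 1 - z ^ b * y) = 1 - y ^ m"
proof -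
  have zm: "z ^ m = 1" using z by simp
  hence z0: "z \<noteq> 0" using m by (auto simp: power_0_left)
  \<comment> \<open>Both sides are polynomials in \<open>y\<close> of degree at most \<open>m\<close> agreeing at \<open>0\<close> and at the \<open>m\<close> powers of \<open>z\<close>.\<close>
  let ?A = "insert 0 ((\<lambda>j. z ^ j) ` {..<m})"
  let ?p = "\<Prod>b<m. [:1, - (z ^ b):]" and ?q = "1 - monom 1 m :: complex poly"
  have "card ?A = Suc m"
    using z0 by (subst card_insert_disjoint) (auto simp: card_image[OF primitive_root_power_inj[OF z z0]])
  moreover have "degree ?p \<le> (\<Sum>b<m. 1)"
    by (rule order.trans[OF degree_prod_sum_le]) (auto intro!: sum_mono simp del: sum_constant)
  moreover have "degree ?q \<le> m"
    by (intro degree_diff_le) (auto simp: degree_monom_le)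
  moreover have "poly ?p x = poly ?q x" if "x \<in> ?A" for x
  proof (cases "x = 0")
    case True
    then show ?thesis using m by (simp add: poly_prod poly_monom)
  next
    case False
    with that obtain j where j: "j < m" "x = z ^ j" by blast
    have "\<exists>b<m. z ^ b * z ^ j = 1"
    \<comment> \<open>The vanishing factor belongs to the inverse power of \<open>z ^ j\<close>. The
      reduction modulo \<open>m\<close> brings the exponent into range when
      \<open>j = 0\<close>.\<close>
    proof (intro exI[of _ "(m - j) mod m"] conjI)
      show "z ^ ((m - j) mod m) * z ^ j = 1"
        using j zm by (cases "j = 0") (simp_all flip: power_add)
    qed (use m in simp)
    then have "poly ?p x = 0" using j by (auto simp: poly_prod prod_zero_iff mult.commute)
    moreover have "x ^ m = 1" using j zm by (metis power_commutes power_mult mult.commute power_one)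
    ultimately show ?thesis by (simp add: poly_monom)
  qed
  ultimately have "?p = ?q" by (intro poly_eqI_degree[of ?A]) auto
  then have "poly ?p y = poly ?q y" by simp
  then show ?thesis by (simp add: poly_prod poly_monom mult.commute)
qed

lemma dvd_mult_iff_div_gcd_dvd:
  fixes n k j :: nat
  assumes "n > 0"
  shows "n dvd k * j \<longleftrightarrow> n div gcd n k dvd j"
proof -
  define g where "g = gcd n k"
  have g: "g > 0" "g dvd n" "g dvd k" using assms by (auto simp: g_def)
  have "n dvd k * j \<longleftrightarrow> g * (n div g) dvd g * (k div g) * j" using g by simp
  also have "\<dots> \<longleftrightarrow> g * (n div g) dvd g * ((k div g) * j)" by (simp only: mult.assoc)
  also have "\<dots> \<longleftrightarrow> n div g dvd (k div g) * j" using g(1) by (simp only: nat_mult_dvd_cancel1)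
  also have "\<dots> \<longleftrightarrow> n div g dvd j"
    using assms by (intro coprime_dvd_mult_right_iff) (auto simp: g_def intro!: div_gcd_coprime)
  finally show ?thesis by (simp add: g_def)
qed

text \<open>The range \<open>j < n\<close> is cut into \<open>gcd n k\<close> runs of length
  \<open>m = n div gcd n k\<close>. As \<open>w ^ k\<close> has order \<open>m\<close>, every run
  contributes the same product \<open>1 - y ^ m\<close>.\<close>

lemma prod_one_minus_root_powers:
  fixes w y :: complex
  assumes n: "n > 0" and w: "\<And>j. w ^ j = 1 \<longleftrightarrow> n dvd j"
  shows "(\<Prod>j<n. 1 - w ^ (j * k) * y) = (1 - y ^ (n div gcd n k)) ^ gcd n k"
proof -
  define g m z where "g = gcd n k" and "m = n div g" and "z = w ^ k"
  have gm: "n = g * m" "m > 0" using n by (auto simp: g_def m_def dvd_imp_le div_greater_zero_iff)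
  have z: "z ^ j = 1 \<longleftrightarrow> m dvd j" for j
    unfolding z_def m_def g_def by (simp add: w dvd_mult_iff_div_gcd_dvd[OF n] flip: power_mult)
  have shift: "z ^ (i * m + b) = z ^ b" for i b
    using z[of m] by (simp add: power_add power_mult mult.commute[of i])
  have "(\<Prod>j<n. 1 - w ^ (j * k) * y) = (\<Prod>j<g * m. 1 - z ^ j * y)"
    unfolding gm(1)[symmetric] z_def by (simp add: mult.commute flip: power_mult)
  also have "\<dots> = (\<Prod>i<g. \<Prod>j\<in>{i * m..<i * m + m}. 1 - z ^ j * y)"
    by (rule prod.nat_group[symmetric])
  also have "\<dots> = (\<Prod>i<g. \<Prod>b<m. 1 - z ^ (i * m + b) * y)"
  proof (rule prod.cong[OF refl])
    fix i
    show "(\<Prod>j\<in>{i * m..<i * m + m}. 1 - z ^ j * y) = (\<Prod>b<m. 1 - z ^ (i * m + b) * y)"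
      by (rule prod.reindex_bij_witness[of _ "\<lambda>b. i * m + b" "\<lambda>j. j - i * m"]) auto
  qed
  also have "\<dots> = (1 - y ^ m) ^ g"
    by (simp add: shift prod_one_minus_primitive_root[OF gm(2) z])
  finally show ?thesis by (simp add: g_def m_def)
qed

section \<open>Diagonalisation of the cyclic permutation matrix\<close>

text \<open>Column \<open>j\<close> of the Fourier matrix is an eigenvector for
  \<open>w ^ j\<close>: the cyclic shift of the row index multiplies \<open>w ^ (i * j)\<close> by
  \<open>w ^ j\<close>, and \<open>w ^ n = 1\<close> takes care of the wrap-around at the last
  row.\<close>

lemma cyclic_perm_mat_mult_dft:
  assumes "w ^ n = 1"
  shows "cyclic_perm_mat n * dft_mat n w = dft_mat n w * power_diag_mat n w 1"
proof (rule eq_matI)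
  fix i j assume "i < dim_row (dft_mat n w * power_diag_mat n w 1)" "j < dim_col (dft_mat n w * power_diag_mat n w 1)"
  hence i: "i < n" and j: "j < n" by (auto simp: dft_mat_def power_diag_mat_def)
  have "(cyclic_perm_mat n * dft_mat n w) $$ (i, j)
      = (\<Sum>l<n. (if l mod n = (i + 1) mod n then 1 else 0) * w ^ (l * j))"
    using i j by (simp add: cyclic_perm_mat_def dft_mat_def scalar_prod_def lessThan_atLeast0)
  also have "\<dots> = (\<Sum>l<n. if l = (i + 1) mod n then w ^ (l * j) else 0)"
    by (rule sum.cong) auto
  also have "\<dots> = w ^ ((i + 1) mod n * j)" using i by simp
  also have "\<dots> = (w ^ ((i + 1) mod n)) ^ j" by (rule power_mult)
  also have "w ^ ((i + 1) mod n) = w ^ (i + 1)"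
    using assms by (metis div_mult_mod_eq mult.commute mult_1 power_add power_mult power_one)
  also have "(w ^ (i + 1)) ^ j = w ^ (i * j) * w ^ j"
    by (simp add: power_mult_distrib flip: power_mult)
  also have "\<dots> = (\<Sum>l<n. if l = j then w ^ (i * l) * w ^ j else 0)" using j by simp
  also have "\<dots> = (dft_mat n w * power_diag_mat n w 1) $$ (i, j)"
    using i j by (simp add: power_diag_mat_def dft_mat_def scalar_prod_def lessThan_atLeast0 if_distrib cong: if_cong)
  finally show "(cyclic_perm_mat n * dft_mat n w) $$ (i, j) = (dft_mat n w * power_diag_mat n w 1) $$ (i, j)" .
qed (auto simp: cyclic_perm_mat_def dft_mat_def power_diag_mat_def)

lemma power_diag_mat_mult:
  "power_diag_mat n w s * power_diag_mat n w t = power_diag_mat n w (s + t)"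
proof (rule eq_matI)
  fix i j assume "i < dim_row (power_diag_mat n w (s + t))" "j < dim_col (power_diag_mat n w (s + t))"
  hence i: "i < n" and j: "j < n" by (auto simp: power_diag_mat_def)
  have "(power_diag_mat n w s * power_diag_mat n w t) $$ (i, j)
     = (\<Sum>l<n. (if i = l then w ^ (l * s) else 0) * (if l = j then w ^ (j * t) else 0))"
    using i j by (simp add: power_diag_mat_def scalar_prod_def lessThan_atLeast0)
  also have "\<dots> = (\<Sum>l<n. if l = i then w ^ (l * s) * (if l = j then w ^ (j * t) else 0) else 0)"
    by (rule sum.cong) auto
  also have "\<dots> = power_diag_mat n w (s + t) $$ (i, j)"
    using i j by (simp add: power_diag_mat_def power_add distrib_left)
  finally show "(power_diag_mat n w s * power_diag_mat n w t) $$ (i, j) = power_diag_mat n w (s + t) $$ (i, j)" .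
qed (auto simp: power_diag_mat_def)

text \<open>An intertwining relation instead of a conjugation: no inverse of the Fourier matrix has
  to be carried along, and its nonzero determinant cancels later.\<close>

lemma cyclic_perm_mat_pow_mult_dft:
  assumes "w ^ n = 1"
  shows "cyclic_perm_mat n ^\<^sub>m s * dft_mat n w = dft_mat n w * power_diag_mat n w s"
proof (induction s)
  case 0
  have "power_diag_mat n w 0 = 1\<^sub>m n" by (rule eq_matI) (auto simp: power_diag_mat_def)
  then show ?case
    by (simp add: carrier_matD[OF cyclic_perm_mat_carrier] left_mult_one_mat[OF dft_mat_carrier] 
        right_mult_one_mat[OF dft_mat_carrier])
next
  case (Suc s)
  note [simp] = pow_carrier_mat[OF cyclic_perm_mat_carrier]
  let ?P = "cyclic_perm_mat n" and ?F = "dft_mat n w" and ?D = "power_diag_mat n w"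
  have "?P ^\<^sub>m Suc s * ?F = ?P ^\<^sub>m s * (?P * ?F)" by (simp add: assoc_mult_mat[of _ n n _ n _ n])
  also have "\<dots> = ?P ^\<^sub>m s * ?F * ?D 1"
    by (simp only: cyclic_perm_mat_mult_dft[OF assms]) (simp add: assoc_mult_mat[of _ n n _ n _ n])
  also have "\<dots> = ?F * (?D s * ?D 1)" by (simp add: Suc.IH assoc_mult_mat[of _ n n _ n _ n])
  finally show ?case by (simp add: power_diag_mat_mult)
qed

text \<open>Orthogonality of the characters of the cyclic group: each entry of the product is a
  geometric sum, divided by \<open>n\<close>, whose ratio is an \<open>n\<close>-th root of
  unity.\<close>

lemma dft_mat_left_inverse:
  assumes n: "n > 0" and w: "\<And>j. w ^ j = 1 \<longleftrightarrow> n dvd j"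
  shows "(1 / of_nat n) \<cdot>\<^sub>m dft_mat n (inverse w) * dft_mat n w = 1\<^sub>m n"
proof (rule eq_matI)
  have wn: "w ^ n = 1" using w by simp
  hence w0: "w \<noteq> 0" using n by (auto simp: power_0_left)
  fix i j assume "i < dim_row (1\<^sub>m n :: complex mat)" "j < dim_col (1\<^sub>m n :: complex mat)"
  hence i: "i < n" and j: "j < n" by auto
  \<comment> \<open>The ratio \<open>w ^ (j - i)\<close>, in a form that is also correct for
    \<open>j < i\<close>, where subtraction of naturals would truncate.\<close>
  define x where "x = inverse w ^ i * w ^ j"
  have "(\<Sum>l<n. x ^ l) = (if i = j then of_nat n else 0)"
  proof (cases "i = j")
    case True
    then show ?thesis using w0 by (simp add: x_def field_simps flip: power_mult_distrib)
  next
    case False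
    have "x \<noteq> 1"
    proof
      assume "x = 1"
      hence "w ^ j = w ^ i" using w0 by (simp add: x_def field_simps)
      with False i j primitive_root_power_inj[OF w w0] show False by (auto dest: inj_onD)
    qed
    moreover have "x ^ n = (inverse w ^ n) ^ i * (w ^ n) ^ j"
      by (simp add: x_def power_mult_distrib mult.commute flip: power_mult)
    ultimately show ?thesis using False wn by (simp add: geometric_sum power_inverse)
  qed
  moreover have "((1 / of_nat n) \<cdot>\<^sub>m dft_mat n (inverse w) * dft_mat n w) $$ (i, j) = (\<Sum>l<n. x ^ l) / of_nat n"
    using i j by (simp add: dft_mat_def scalar_prod_def lessThan_atLeast0 x_def power_mult_distrib sum_divide_distrib
       mult.commute[of j] flip: power_mult)
  ultimately show "((1 / of_nat n) \<cdot>\<^sub>m dft_mat n (inverse w) * dft_mat n w) $$ (i, j) = 1\<^sub>m n $$ (i, j)"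
    using i j n by simp
qed (auto simp: dft_mat_def)

section \<open>The determinant of the pencil as a product over roots of unity\<close>

text \<open>By the mixed-product property a left inverse of the Fourier matrix yields a left inverse
  of its Kronecker product with the identity.\<close>

lemma det_kronecker_dft_nonzero:
  assumes n: "n > 0" and w: "\<And>j. w ^ j = 1 \<longleftrightarrow> n dvd j"
  shows "det (kronecker_mat (dft_mat n w) (1\<^sub>m r)) \<noteq> 0"
proof -
  let ?F = "dft_mat n w" and ?G = "(1 / of_nat n) \<cdot>\<^sub>m dft_mat n (inverse w)"
  have G: "?G \<in> carrier_mat n n" by simp
  have I: "1\<^sub>m r \<in> carrier_mat r r" by simp
  have "kronecker_mat ?G (1\<^sub>m r) * kronecker_mat ?F (1\<^sub>m r) = 1\<^sub>m (n * r)"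
    by (simp add: kronecker_mat_mult[OF G I dft_mat_carrier I] dft_mat_left_inverse[OF n w] kronecker_mat_one)
  then have "det (kronecker_mat ?G (1\<^sub>m r)) * det (kronecker_mat ?F (1\<^sub>m r)) = 1"
    by (simp flip: det_mult[OF kronecker_mat_carrier[OF G I] kronecker_mat_carrier[OF dft_mat_carrier I]])
  then show ?thesis by auto
qed

text \<open>The Kronecker product of the Fourier matrix with \<open>1\<^sub>m r\<close> intertwines
  the pencil with the one in which the cyclic powers are replaced by diagonal matrices. Cancelling
  its determinant leaves a block diagonal matrix.\<close>

lemma det_kronecker_cyclic_pencil:
  assumes n: "n > 0" and w: "\<And>j. w ^ j = 1 \<longleftrightarrow> n dvd j"
    and A: "A \<in> carrier_mat r r" and B: "B \<in> carrier_mat r r"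
  shows "det (kronecker_mat (cyclic_perm_mat n ^\<^sub>m s) A + kronecker_mat (cyclic_perm_mat n ^\<^sub>m t) B)
    = (\<Prod>j<n. det (w ^ (j * s) \<cdot>\<^sub>m A + w ^ (j * t) \<cdot>\<^sub>m B))"
proof -
  have wn: "w ^ n = 1" using w by simp
  let ?P = "\<lambda>s. cyclic_perm_mat n ^\<^sub>m s" and ?F = "dft_mat n w" and ?D = "power_diag_mat n w"
  let ?M = "kronecker_mat (?P s) A + kronecker_mat (?P t) B"
  let ?N = "kronecker_mat (?D s) A + kronecker_mat (?D t) B"
  let ?K = "kronecker_mat ?F (1\<^sub>m r)"
  have I: "1\<^sub>m r \<in> carrier_mat r r" by simp
  have F: "?F \<in> carrier_mat n n" and D: "?D s \<in> carrier_mat n n" for s by simp_all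
  have P: "?P s \<in> carrier_mat n n" for s by (simp add: pow_carrier_mat)
  have K: "?K \<in> carrier_mat (n * r) (n * r)" by (rule kronecker_mat_carrier[OF F I])
  have PA: "kronecker_mat (?P s) X \<in> carrier_mat (n * r) (n * r)" 
    and DA: "kronecker_mat (?D s) X \<in> carrier_mat (n * r) (n * r)" if "X \<in> carrier_mat r r" for s X
    using that P D by (auto intro: kronecker_mat_carrier)
  \<comment> \<open>Both sides are a single Kronecker product with right factor \<open>X\<close>;
    the left factors agree by the intertwining relation.\<close>
  have comm: "kronecker_mat (?P s) X * ?K = ?K * kronecker_mat (?D s) X" if X: "X \<in> carrier_mat r r" for s X
    using X by (simp add: kronecker_mat_mult[OF P X F I] kronecker_mat_mult[OF F I D X] cyclic_perm_mat_pow_mult_dft[OF wn])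
  have "?M * ?K = ?K * ?N"
    by (simp add: add_mult_distrib_mat[OF PA[OF A] PA[OF B] K] mult_add_distrib_mat[OF K DA[OF A] DA[OF B]] comm A B)
  then have "det (?M * ?K) = det (?K * ?N)" by simp
  then have "det ?M * det ?K = det ?K * det ?N"
    using PA[OF A, of s] PA[OF B, of t] DA[OF A, of s] DA[OF B, of t] K by (simp add: det_mult[of _ "n * r"])
  then have "det ?M = det ?N" using det_kronecker_dft_nonzero[OF n w, of r] by simp
  also have "?N = mat (n * r) (n * r) (\<lambda>(i, j). if i div r = j div r
      then (w ^ (i div r * s) \<cdot>\<^sub>m A + w ^ (i div r * t) \<cdot>\<^sub>m B) $$ (i mod r, j mod r) else 0)"
  proof (rule eq_matI)
    fix i j assume "i < dim_row (mat (n * r) (n * r) (\<lambda>(i, j). if i div r = j div r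
      then (w ^ (i div r * s) \<cdot>\<^sub>m A + w ^ (i div r * t) \<cdot>\<^sub>m B) $$ (i mod r, j mod r) else 0))"
     "j < dim_col (mat (n * r) (n * r) (\<lambda>(i, j). if i div r = j div r
      then (w ^ (i div r * s) \<cdot>\<^sub>m A + w ^ (i div r * t) \<cdot>\<^sub>m B) $$ (i mod r, j mod r) else 0))"
    hence i: "i < n * r" and j: "j < n * r" by auto
    hence ij: "i div r < n" "i mod r < r" "j div r < n" "j mod r < r"
      by (auto simp: less_mult_imp_div_less intro!: mod_less_divisor gr0I)
    have "?N $$ (i, j) = ?D s $$ (i div r, j div r) * A $$ (i mod r, j mod r)
        + ?D t $$ (i div r, j div r) * B $$ (i mod r, j mod r)"
      using i j DA[OF A, of s] DA[OF B, of t]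
      by (simp add: kronecker_mat_index[OF D A i j] kronecker_mat_index[OF D B i j])
    then show "?N $$ (i, j) = mat (n * r) (n * r) (\<lambda>(i, j). if i div r = j div r
      then (w ^ (i div r * s) \<cdot>\<^sub>m A + w ^ (i div r * t) \<cdot>\<^sub>m B) $$ (i mod r, j mod r) else 0) $$ (i, j)"
      using i j ij A B by (simp add: power_diag_mat_def)
  qed (use DA[OF B, of t] in auto)
  also have "det \<dots> = (\<Prod>j<n. det (w ^ (j * s) \<cdot>\<^sub>m A + w ^ (j * t) \<cdot>\<^sub>m B))"
    by (rule det_block_diagonal) (use A B in auto)
  finally show ?thesis .
qed

text \<open>The same cancellation without blocks. It turns the product of the scalars pulled out of
  the blocks back into the determinant in the final formula.\<close>

lemma det_cyclic_perm_mat_pow: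
  assumes n: "n > 0" and w: "\<And>j. w ^ j = 1 \<longleftrightarrow> n dvd j"
  shows "det (cyclic_perm_mat n ^\<^sub>m s) = (\<Prod>j<n. w ^ (j * s))"
proof -
  have wn: "w ^ n = 1" using w by simp
  let ?P = "cyclic_perm_mat n ^\<^sub>m s" and ?F = "dft_mat n w" and ?D = "power_diag_mat n w s"
  have P: "?P \<in> carrier_mat n n" by (simp add: pow_carrier_mat)
  have "det ?F \<noteq> 0"
    using arg_cong[OF dft_mat_left_inverse[OF n w], of det] by (auto simp: det_mult[of _ n])
  moreover have "det ?P * det ?F = det ?F * det ?D"
    using arg_cong[OF cyclic_perm_mat_pow_mult_dft[OF wn, of s], of det] P by (simp add: det_mult[of _ n])
  ultimately have "det ?P = det ?D" by simp
  also have "\<dots> = prod_list (diag_mat ?D)"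
    by (rule det_upper_triangular[of _ n]) (auto simp: power_diag_mat_def)
  also have "\<dots> = (\<Prod>j<n. w ^ (j * s))"
    by (simp add: diag_mat_def power_diag_mat_def lessThan_atLeast0 flip: prod.distinct_set_conv_list)
  finally show ?thesis .
qed

section \<open>Triangularisation and determinants of
  \<open>1\<^sub>m r - x \<cdot>\<^sub>m C ^\<^sub>m m\<close>\<close>

text \<open>A summand \<open>U $$ (i, l) * V $$ (l, j)\<close> can be nonzero only if
  \<open>i \<le> l \<le> j\<close>: none survives below the diagonal, and only \<open>l = i\<close>
  on it.\<close>

lemma upper_triangular_mult:
  fixes U V :: "'a :: comm_semiring_1 mat"
  assumes U: "U \<in> carrier_mat n n" and V: "V \<in> carrier_mat n n"
    and u: "upper_triangular U" and v: "upper_triangular V"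
  shows "upper_triangular (U * V)" and "i < n \<Longrightarrow> (U * V) $$ (i, i) = U $$ (i, i) * V $$ (i, i)"
proof -
  have ent: "(U * V) $$ (i, j) = (\<Sum>l<n. U $$ (i, l) * V $$ (l, j))" if "i < n" "j < n" for i j
    using that U V by (simp add: scalar_prod_def lessThan_atLeast0)
  show "upper_triangular (U * V)"
  proof (rule upper_triangularI)
    fix i j assume "j < i" "i < dim_row (U * V)"
    hence ij: "j < i" "i < n" "j < n" using U by auto
    have "U $$ (i, l) * V $$ (l, j) = 0" if "l < n" for l
      using upper_triangularD[OF u, of l i] upper_triangularD[OF v, of j l] ij that U V
      by (cases "l < i") auto
    then show "(U * V) $$ (i, j) = 0" using ij by (simp add: ent)
  qed
  assume i: "i < n"
  have "U $$ (i, l) * V $$ (l, i) = (if l = i then U $$ (i, i) * V $$ (i, i) else 0)" if "l < n" for l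
    using upper_triangularD[OF u, of l i] upper_triangularD[OF v, of i l] i that U V
    by (cases l i rule: linorder_cases) auto
  then have "(U * V) $$ (i, i) = (\<Sum>l<n. if l = i then U $$ (i, i) * V $$ (i, i) else 0)"
    unfolding ent[OF i i] by (intro sum.cong) auto
  then show "(U * V) $$ (i, i) = U $$ (i, i) * V $$ (i, i)" using i by simp
qed

lemma upper_triangular_pow:
  fixes U :: "'a :: comm_semiring_1 mat"
  assumes U: "U \<in> carrier_mat n n" and u: "upper_triangular U"
  shows "upper_triangular (U ^\<^sub>m k) \<and> (\<forall>i<n. (U ^\<^sub>m k) $$ (i, i) = (U $$ (i, i)) ^ k)"
proof (induction k)
  case (Suc k)
  have "(U ^\<^sub>m k * U) $$ (i, i) = U $$ (i, i) ^ Suc k" if "i < n" for i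
    using upper_triangular_mult(2)[OF pow_carrier_mat[OF U] U _ u that, of k] Suc.IH that
    by (simp only: power_Suc2)
  moreover have "upper_triangular (U ^\<^sub>m k * U)"
    using upper_triangular_mult(1)[OF pow_carrier_mat[OF U] U _ u] Suc.IH by blast
  ultimately show ?case by (simp only: pow_mat.simps) blast
qed (use U in auto)

lemma det_one_minus_smult_pow:
  fixes C :: "complex mat"
  assumes C: "C \<in> carrier_mat r r"
  obtains t where "\<And>x m. det (1\<^sub>m r - x \<cdot>\<^sub>m C ^\<^sub>m m) = (\<Prod>i<r. 1 - x * t i ^ m)"
proof -
  \<comment> \<open>The \<open>t i\<close> are the eigenvalues of \<open>C\<close>, read off the diagonal of a Schur form.\<close>
  obtain es where "char_poly C = (\<Prod>a\<leftarrow>es. [:- a, 1:])" using char_poly_factorized[OF C] by auto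
  from schur_decomposition_exists[OF C this] obtain U
    where U: "U \<in> carrier_mat r r" and u: "upper_triangular U" and "similar_mat C U" by auto
  then obtain P Q where wit: "similar_mat_wit C U P Q" unfolding similar_mat_def by auto
  note PQ = similar_mat_witD2[OF C wit]
  show ?thesis
  proof
    fix x m
    let ?C = "C ^\<^sub>m m" and ?U = "U ^\<^sub>m m"
    have Um: "?U \<in> carrier_mat r r" and xU: "x \<cdot>\<^sub>m ?U \<in> carrier_mat r r" using U by simp_all
    have Cm: "?C = P * ?U * Q" by (rule similar_mat_wit_pow_id[OF wit])
    \<comment> \<open>Conjugation by \<open>P\<close> and its inverse \<open>Q\<close> fixes the
      identity and takes \<open>U ^\<^sub>m m\<close> to \<open>C ^\<^sub>m m\<close>, so the
      determinant can be computed on the triangular side.\<close>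
    have "P * (1\<^sub>m r - x \<cdot>\<^sub>m ?U) * Q = (P * 1\<^sub>m r - P * (x \<cdot>\<^sub>m ?U)) * Q"
      using mult_minus_distrib_mat[OF PQ(6) one_carrier_mat xU] by simp
    also have "\<dots> = P * 1\<^sub>m r * Q - P * (x \<cdot>\<^sub>m ?U) * Q"
      by (rule minus_mult_distrib_mat[OF _ _ PQ(7)]) (use PQ(6) xU in auto)
    also have "\<dots> = 1\<^sub>m r - x \<cdot>\<^sub>m ?C"
      unfolding Cm mult_smult_distrib[OF PQ(6) Um]
        mult_smult_assoc_mat[OF mult_carrier_mat[OF PQ(6) Um] PQ(7)] right_mult_one_mat[OF PQ(6)] PQ(1) ..
    finally have eq: "1\<^sub>m r - x \<cdot>\<^sub>m ?C = P * (1\<^sub>m r - x \<cdot>\<^sub>m ?U) * Q" by simp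
    have "det P * det Q = 1" using det_mult[OF PQ(6,7)] PQ(1) by simp
    moreover have "det (1\<^sub>m r - x \<cdot>\<^sub>m ?C) = det P * det (1\<^sub>m r - x \<cdot>\<^sub>m ?U) * det Q"
      unfolding eq using PQ(6,7) minus_carrier_mat[OF xU, of "1\<^sub>m r"]
      by (simp only: det_mult[of _ r] mult_carrier_mat[of _ r r _ r])
    ultimately have "det (1\<^sub>m r - x \<cdot>\<^sub>m ?C) = det (1\<^sub>m r - x \<cdot>\<^sub>m ?U)"
      by (metis mult.assoc mult.commute mult_1)
    also have "\<dots> = prod_list (diag_mat (1\<^sub>m r - x \<cdot>\<^sub>m ?U))"
    proof (rule det_upper_triangular)
      show "upper_triangular (1\<^sub>m r - x \<cdot>\<^sub>m ?U)"
        using upper_triangularD[of ?U] upper_triangular_pow[OF U u, of m] U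
        by (intro upper_triangularI) auto
    qed (use xU in \<open>rule minus_carrier_mat\<close>)
    also have "\<dots> = (\<Prod>i<r. 1 - x * (U $$ (i, i)) ^ m)"
      using upper_triangular_pow[OF U u, of m] U
      by (simp add: diag_mat_def lessThan_atLeast0 flip: prod.distinct_set_conv_list)
    finally show "det (1\<^sub>m r - x \<cdot>\<^sub>m ?C) = (\<Prod>i<r. 1 - x * (U $$ (i, i)) ^ m)" .
  qed
qed

text \<open>The same eigenvalues \<open>t i\<close> serve all \<open>x\<close> and \<open>m\<close>:
  the instance \<open>m = 1\<close> opens the left side and \<open>x = 1\<close> closes the right.
  In between, the products are swapped and the scalar identity is applied to each
  eigenvalue.\<close>

lemma prod_det_one_minus_root_powers:
  fixes C :: "complex mat"
  assumes n: "n > 0" and w: "\<And>j. w ^ j = 1 \<longleftrightarrow> n dvd j" and C: "C \<in> carrier_mat r r"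
  shows "(\<Prod>j<n. det (1\<^sub>m r - w ^ (j * k) \<cdot>\<^sub>m C)) = det (1\<^sub>m r - C ^\<^sub>m (n div gcd n k)) ^ gcd n k"
proof -
  obtain t where t: "\<And>x m. det (1\<^sub>m r - x \<cdot>\<^sub>m C ^\<^sub>m m) = (\<Prod>i<r. 1 - x * t i ^ m)"
    using det_one_minus_smult_pow[OF C] by blast
  have C1: "C ^\<^sub>m 1 = C" using C by simp
  have one: "1 \<cdot>\<^sub>m X = X" for X :: "complex mat" by (rule eq_matI) auto
  have "(\<Prod>j<n. det (1\<^sub>m r - w ^ (j * k) \<cdot>\<^sub>m C)) = (\<Prod>j<n. \<Prod>i<r. 1 - w ^ (j * k) * t i)"
    using t[of _ 1] unfolding C1 by simp
  also have "\<dots> = (\<Prod>i<r. \<Prod>j<n. 1 - w ^ (j * k) * t i)" by (rule prod.swap)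
  also have "\<dots> = (\<Prod>i<r. 1 - t i ^ (n div gcd n k)) ^ gcd n k"
    by (simp add: prod_one_minus_root_powers[OF n w] prod_power_distrib)
  also have "\<dots> = det (1\<^sub>m r - C ^\<^sub>m (n div gcd n k)) ^ gcd n k"
    using t[of 1 "n div gcd n k"] by (simp add: one)
  finally show ?thesis .
qed

section \<open>Factoring out the invertible coefficient\<close>

text \<open>An invertible matrix is a unit of the matrix ring, so \<open>mat_inverse\<close> does
  not return \<open>None\<close> and \<open>the\<close> yields a genuine inverse.\<close>

lemma inv_mat_right_inverse:
  fixes A :: "'a :: field mat"
  assumes A: "A \<in> carrier_mat r r" and inv: "invertible_mat A"
  shows "A * inv_mat A = 1\<^sub>m r" and "inv_mat A \<in> carrier_mat r r"
proof -
  obtain B where B: "A * B = 1\<^sub>m r" "B * A = 1\<^sub>m (dim_row B)"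
    using inv A unfolding invertible_mat_def inverts_mat_def by auto
  \<comment> \<open>The witness from \<open>invertible_mat_def\<close> comes without a carrier; its
    dimensions are read off the two products.\<close>
  have dims: "dim_col B = r" "dim_row B = r" 
    using A arg_cong[OF B(1), of dim_col] arg_cong[OF B(2), of dim_col] by auto
  hence "A \<in> Units (ring_mat TYPE('a) r ())"
    using A B unfolding Units_def ring_mat_def by (auto intro!: bexI[of _ B])
  then obtain X where X: "mat_inverse A = Some X" using mat_inverse(1)[OF A, of "()"] by (cases "mat_inverse A") auto
  with mat_inverse(2)[OF A X] show "A * inv_mat A = 1\<^sub>m r" "inv_mat A \<in> carrier_mat r r"
    by (auto simp: inv_mat_def)
qed

text \<open>The offset \<open>k\<close> is fixed only modulo \<open>n\<close>, so the lemma covers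
  both a forward step from \<open>s\<close> to \<open>t\<close> and one that wraps around. Each
  block factors as \<open>w ^ (j * s)\<close> times \<open>A\<close> times
  \<open>1\<^sub>m r - w ^ (j * k) \<cdot>\<^sub>m C\<close>; the scalar enters the determinant with
  exponent \<open>r\<close>.\<close>

lemma det_kronecker_cyclic_pencil_invertible:
  fixes A B :: "complex mat"
  assumes n: "n > 0" and A: "A \<in> carrier_mat r r" and B: "B \<in> carrier_mat r r"
    and inv: "invertible_mat A" and cong: "(s + k) mod n = t mod n"
  shows "det (kronecker_mat (cyclic_perm_mat n ^\<^sub>m s) A + kronecker_mat (cyclic_perm_mat n ^\<^sub>m t) B)
    = det (cyclic_perm_mat n ^\<^sub>m s) ^ r * det A ^ n
      * det (1\<^sub>m r - (- (inv_mat A * B)) ^\<^sub>m div_gcd n k) ^ gcd n k"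
proof -
  obtain w :: complex where w: "\<And>j. w ^ j = 1 \<longleftrightarrow> n dvd j" using ex_primitive_root_unity[OF n] by blast
  have red: "w ^ j = w ^ (j mod n)" for j
    using w[of n] by (metis dvd_refl div_mult_mod_eq mult.commute mult_1 power_add power_mult power_one)
  note I = inv_mat_right_inverse[OF A inv]
  define C where "C = - (inv_mat A * B)"
  have C: "C \<in> carrier_mat r r" using I B by (simp add: C_def)
  have BC: "B = - (A * C)"
    using A B I by (simp add: C_def flip: assoc_mult_mat[of A r r "inv_mat A" r B r])
  have "det (w ^ (j * s) \<cdot>\<^sub>m A + w ^ (j * t) \<cdot>\<^sub>m B)
      = (w ^ (j * s)) ^ r * det A * det (1\<^sub>m r - w ^ (j * k) \<cdot>\<^sub>m C)" for j
  proof -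
    have "(j * t) mod n = (j * (s + k)) mod n" by (metis cong mod_mult_right_eq)
    then have "w ^ (j * t) = w ^ (j * s) * w ^ (j * k)"
      using red[of "j * t"] red[of "j * (s + k)"] by (simp add: distrib_left power_add)
    then have "w ^ (j * s) \<cdot>\<^sub>m A + w ^ (j * t) \<cdot>\<^sub>m B = w ^ (j * s) \<cdot>\<^sub>m (A - w ^ (j * k) \<cdot>\<^sub>m (A * C))"
      using A C by (intro eq_matI) (auto simp: BC algebra_simps)
    also have "A - w ^ (j * k) \<cdot>\<^sub>m (A * C) = A * (1\<^sub>m r - w ^ (j * k) \<cdot>\<^sub>m C)"
      using A C by (simp add: mult_minus_distrib_mat[of _ r r _ r] mult_smult_distrib[of _ r r _ r])
    finally show ?thesis using A C by (simp add: det_mult[of _ r] minus_carrier_mat)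
  qed
  then have "det (kronecker_mat (cyclic_perm_mat n ^\<^sub>m s) A + kronecker_mat (cyclic_perm_mat n ^\<^sub>m t) B)
      = (\<Prod>j<n. w ^ (j * s)) ^ r * det A ^ n * (\<Prod>j<n. det (1\<^sub>m r - w ^ (j * k) \<cdot>\<^sub>m C))"
    by (simp add: det_kronecker_cyclic_pencil[OF n w A B] prod.distrib prod_power_distrib)
  then show ?thesis
    unfolding prod_det_one_minus_root_powers[OF n w C] det_cyclic_perm_mat_pow[OF n w, symmetric]
    by (simp only: div_gcd_def C_def)
qed

theorem theorem8p3:
  fixes n s1 s2 r :: nat and A B :: "complex mat"
  assumes "s1 < s2" and "s2 \<le> n - 1"
    and "A \<in> carrier_mat r r" and "B \<in> carrier_mat r r"
    and "A \<noteq> 0\<^sub>m r r" and "B \<noteq> 0\<^sub>m r r"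
    and "A * B = B * A"
  shows "(invertible_mat A \<longrightarrow>
           det (kronecker_mat (cyclic_perm_mat n ^\<^sub>m s1) A + kronecker_mat (cyclic_perm_mat n ^\<^sub>m s2) B)
             = det (cyclic_perm_mat n ^\<^sub>m s1) ^ r * det A ^ n
               * det (1\<^sub>m r - (- (inv_mat A * B)) ^\<^sub>m div_gcd n (s2 - s1)) ^ gcd n (s2 - s1))
       \<and> (invertible_mat B \<and> \<not> invertible_mat A \<longrightarrow>
           det (kronecker_mat (cyclic_perm_mat n ^\<^sub>m s1) A + kronecker_mat (cyclic_perm_mat n ^\<^sub>m s2) B)
             = det (cyclic_perm_mat n ^\<^sub>m s2) ^ r * det B ^ n
               * det (1\<^sub>m r - (- (inv_mat B * A)) ^\<^sub>m div_gcd n (n - s2 + s1)) ^ gcd n (n - s2 + s1))"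
proof (intro conjI impI)
  have n: "n > 0" and s: "s1 < n" "s2 < n" using assms(1,2) by auto
  note A = assms(3) and B = assms(4)
  have P: "cyclic_perm_mat n ^\<^sub>m s \<in> carrier_mat n n" for s by (simp add: pow_carrier_mat)
  {
    assume "invertible_mat A"
    then show "det (kronecker_mat (cyclic_perm_mat n ^\<^sub>m s1) A + kronecker_mat (cyclic_perm_mat n ^\<^sub>m s2) B)
             = det (cyclic_perm_mat n ^\<^sub>m s1) ^ r * det A ^ n
               * det (1\<^sub>m r - (- (inv_mat A * B)) ^\<^sub>m div_gcd n (s2 - s1)) ^ gcd n (s2 - s1)"
      by (rule det_kronecker_cyclic_pencil_invertible[OF n A B]) (use assms(1) in simp)
  next
    assume "invertible_mat B \<and> \<not> invertible_mat A"
    then have inv: "invertible_mat B" ..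
    \<comment> \<open>With the roles of \<open>A\<close> and \<open>B\<close> exchanged, the step
      leads from \<open>s2\<close> to the smaller \<open>s1\<close>, hence once around the
      cycle.\<close>
    have "s2 + (n - s2 + s1) = s1 + n" using s by simp
    then have "(s2 + (n - s2 + s1)) mod n = s1 mod n" by (simp only: mod_add_self2)
    from det_kronecker_cyclic_pencil_invertible[OF n B A inv this]
    show "det (kronecker_mat (cyclic_perm_mat n ^\<^sub>m s1) A + kronecker_mat (cyclic_perm_mat n ^\<^sub>m s2) B)
             = det (cyclic_perm_mat n ^\<^sub>m s2) ^ r * det B ^ n
               * det (1\<^sub>m r - (- (inv_mat B * A)) ^\<^sub>m div_gcd n (n - s2 + s1)) ^ gcd n (n - s2 + s1)"
      by (simp add: comm_add_mat[OF kronecker_mat_carrier[OF P B] kronecker_mat_carrier[OF P A]])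
  }
qed

end
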